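(* Let $X,Y$ be Banach spaces, $\mathcal{N}\colon D(\mathcal{N})\subset X\to Y$ an operator with an isolated root $u^{*}\in D(\mathcal{N})$, $\mathcal{N}(u^{*})=0$, and $U\subset D(\mathcal{N})$ an open neighborhood containing $u^{*}$. Let $\{u^{(k)}\}_{k\ge 0}$ be generated by the LiL-Q iteration, with increments $\delta u^{(k)}=u^{(k+1)}-u^{(k)}$ and projection residuals $$r^{(k)}:=\mathcal{N}'(u^{(k)})(\delta u^{(k)})+\mathcal{N}(u^{(k)})\in Y .$$ Suppose that: (i) $\mathcal{N}$ is continuously Fréchet differentiable on $U$, i.e. $\mathcal{N}\in C^{1}(U;Y)$; (ii) there exists $\Gamma>0$ such that $\|\mathcal{N}'(u)\|_{\mathcal{L}(X,Y)}\le\Gamma$ for all $u\in U$; (iii) $u^{(k)}\in U$ for all $k\ge 0$; (iv) there is a constant $\varepsilon_{L}>0$ such that $\|r^{(k)}\|_{Y}\ge\varepsilon_{L}$ for all $k\ge 0$. If the sequence $\{u^{(k)}\}$ converges to a limit $\hat u\in U$, then $$\|\mathcal{N}(\hat u)\|_{Y}=\lim_{k\to\infty}\|r^{(k)}\|_{Y}\ge\varepsilon_{L}>0 .$$ In particular, $\hat u\ne u^{*}$.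
   Context: LiL-Q iteration: let $\phi_1,\dots,\phi_P\in X$ be fixed basis functions and $V_P=\mathrm{span}\{\phi_1,\dots,\phi_P\}\subset X$. Starting from $u^{(0)}\in V_P$, given $u^{(k)}$ the next iterate $u^{(k+1)}\in V_P$ is obtained by solving, in the least-squares sense over $V_P$, the quasilinearized (linear) equation $$\mathcal{N}'(u^{(k)})(u^{(k+1)})=\mathcal{N}'(u^{(k)})(u^{(k)})-\mathcal{N}(u^{(k)}),$$ where $\mathcal{N}'(u)$ denotes the Fréchet derivative. Since $u^{(k+1)}$ is restricted to $V_P$, the equation is in general not satisfied exactly, and $r^{(k)}\in Y$, as defined in the claim, is the residual remaining after the least-squares solve. The iteration enters the statement only through the sequence $\{u^{(k)}\}$ and the residuals $r^{(k)}$. *)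

theory Defs
  imports "HOL-Analysis.Analysis"
begin

definition C1_with_deriv_on ::
  "('a::real_normed_vector \<Rightarrow> 'b::real_normed_vector) \<Rightarrow> ('a \<Rightarrow> 'a \<Rightarrow>\<^sub>L 'b) \<Rightarrow> 'a set \<Rightarrow> bool"
where
  "C1_with_deriv_on N N' U \<longleftrightarrow>
     (\<forall>u\<in>U. (N has_derivative blinfun_apply (N' u)) (at u)) \<and> continuous_on U N'"

(* The target space is only assumed to be normed, so a least-squares solution over the
   trial space V is a minimiser over V of the norm of the residual of the linear equation
   N'(u) v = N'(u) u - N(u). Minimisers need not be unique; any choice is admitted. *)
definition lilq_step ::
  "('a::real_normed_vector \<Rightarrow> 'b::real_normed_vector) \<Rightarrow> ('a \<Rightarrow> 'a \<Rightarrow>\<^sub>L 'b) \<Rightarrow> 'a set \<Rightarrow> 'a \<Rightarrow> 'a \<Rightarrow> bool"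
where
  "lilq_step N N' V u v \<longleftrightarrow>
     is_arg_min (\<lambda>w. norm (blinfun_apply (N' u) w - (blinfun_apply (N' u) u - N u))) (\<lambda>w. w \<in> V) v"

definition lilq_iteration ::
  "('a::real_normed_vector \<Rightarrow> 'b::real_normed_vector) \<Rightarrow> ('a \<Rightarrow> 'a \<Rightarrow>\<^sub>L 'b) \<Rightarrow> 'a set \<Rightarrow> (nat \<Rightarrow> 'a) \<Rightarrow> bool"
where
  "lilq_iteration N N' V u \<longleftrightarrow> u 0 \<in> V \<and> (\<forall>k. lilq_step N N' V (u k) (u (Suc k)))"

definition lilq_residual ::
  "('a::real_normed_vector \<Rightarrow> 'b::real_normed_vector) \<Rightarrow> ('a \<Rightarrow> 'a \<Rightarrow>\<^sub>L 'b) \<Rightarrow> (nat \<Rightarrow> 'a) \<Rightarrow> nat \<Rightarrow> 'b"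
where
  "lilq_residual N N' u k = blinfun_apply (N' (u k)) (u (Suc k) - u k) + N (u k)"

end

theory Submission
  imports Defs
begin

text \<open>Convergence of the iterates forces the increments to 0, while the operators
  \<open>N' (u k)\<close> converge and so stay bounded along the sequence. The linear term of the
  residual therefore vanishes in the limit, and what survives is \<open>N u_hat\<close>, by
  continuity of \<open>N\<close>. The uniform lower bound on the residuals passes to the limit, so
  \<open>u_hat\<close> cannot be a root of \<open>N\<close>.\<close>

theorem theorem1:
  fixes N :: "'a::banach \<Rightarrow> 'b::banach"
    and N' :: "'a \<Rightarrow> 'a \<Rightarrow>\<^sub>L 'b"
    and D U :: "'a set"
    and \<phi> :: "nat \<Rightarrow> 'a" and P :: nat
    and u :: "nat \<Rightarrow> 'a" and u_star u_hat :: 'a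
    and \<Gamma> \<epsilon>\<^sub>L :: real
  assumes root: "u_star isolated_in {v \<in> D. N v = 0}"
    and nbhd: "open U" "u_star \<in> U" "U \<subseteq> D"
    and iteration: "lilq_iteration N N' (span (\<phi> ` {1..P})) u"
    and C1: "C1_with_deriv_on N N' U"
    and bound: "\<Gamma> > 0" "\<And>v. v \<in> U \<Longrightarrow> norm (N' v) \<le> \<Gamma>"
    and stay: "\<And>k. u k \<in> U"
    and resid: "\<epsilon>\<^sub>L > 0" "\<And>k. norm (lilq_residual N N' u k) \<ge> \<epsilon>\<^sub>L"
    and limit: "u \<longlonglongrightarrow> u_hat" "u_hat \<in> U"
  shows "((\<lambda>k. norm (lilq_residual N N' u k)) \<longlonglongrightarrow> norm (N u_hat))
    \<and> norm (N u_hat) \<ge> \<epsilon>\<^sub>L \<and> \<epsilon>\<^sub>L > 0 \<and> u_hat \<noteq> u_star"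
proof (intro conjI)
  have incr: "(\<lambda>k. u (Suc k) - u k) \<longlonglongrightarrow> 0"
    using tendsto_diff[OF LIMSEQ_Suc[OF limit(1)] limit(1)] by simp
  have "continuous_on U N'"
    using C1 by (simp add: C1_with_deriv_on_def)
  \<comment> \<open>Convergence here is in operator norm, the topology of the type of bounded linear
    maps.\<close>
  then have deriv: "(\<lambda>k. N' (u k)) \<longlonglongrightarrow> N' u_hat"
    using limit stay by (auto intro: continuous_on_tendsto_compose)
  have "(N has_derivative blinfun_apply (N' u_hat)) (at u_hat)"
    using C1 limit(2) by (simp add: C1_with_deriv_on_def)
  then have "(\<lambda>k. N (u k)) \<longlonglongrightarrow> N u_hat"
    using limit(1) by (blast intro: isCont_tendsto_compose has_derivative_continuous)
  \<comment> \<open>Evaluation of a bounded linear map at a vector is jointly continuous, so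
    operator and increment may vary together. The limit keeps the term \<open>N' u_hat 0\<close>, in
    the shape the limit rules produce; linearity removes it afterwards.\<close>
  then have "lilq_residual N N' u \<longlonglongrightarrow> N' u_hat 0 + N u_hat"
    unfolding lilq_residual_def using incr deriv by (intro tendsto_intros)
  then show lim: "(\<lambda>k. norm (lilq_residual N N' u k)) \<longlonglongrightarrow> norm (N u_hat)"
    by (auto dest: tendsto_norm)
  show le: "\<epsilon>\<^sub>L \<le> norm (N u_hat)"
    using LIMSEQ_le_const[OF lim] resid(2) by blast
  show "\<epsilon>\<^sub>L > 0" by (fact resid(1))
  have "N u_star = 0"
    using root by (auto simp: isolated_in_def)
  then show "u_hat \<noteq> u_star"
    using le resid(1) by auto
qed

end
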